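(* Let $L=\bigoplus_{n\ge1}L_n$ be a graded Lie algebra over $\mathbb{Q}$, let $\delta$ be a graded Lie derivation of $L$ (not assumed invertible), extended to a derivation of $U(L)$, and let $D_\delta:=S\ast\delta$. For every $l\in L$, $$D_\delta(\exp(l))=\frac{\exp(-\mathrm{ad}_l)-1}{-\mathrm{ad}_l}\,\delta(l).$$
   Context: $U(L)=\bigoplus_{n\ge0}U(L)_n$ is the graded enveloping algebra of $L$ with its canonical Hopf algebra structure (product $\mu$, coproduct $\Delta$, antipode $S$), and $\hat U(L)=\prod_{n\ge0}U(L)_n$ is its completion, in which $\exp(l)=\sum_{n\ge0}l^n/n!$ is defined. A graded Lie derivation $\delta$ of $L$ is a degree-preserving linear map with $\delta([l,l'])=[\delta(l),l']+[l,\delta(l')]$; it extends uniquely to a derivation of $U(L)$, and all graded maps extend to completions degree by degree. The convolution product of linear endomorphisms is $f\ast g=\mu\circ(f\otimes g)\circ\Delta$. $\mathrm{ad}_l(y)=[l,y]$, and $\frac{\exp(-\mathrm{ad}_l)-1}{-\mathrm{ad}_l}$ denotes the power series $\sum_{i\ge0}\frac{1}{(i+1)!}(-\mathrm{ad}_l)^i$. *)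

theory Defs
  imports "HOL-Computational_Algebra.Formal_Power_Series"
begin

section \<open>Vector spaces and algebras over the rationals\<close>

class rat_vector = ab_group_add +
  fixes scaleQ :: "rat \<Rightarrow> 'a \<Rightarrow> 'a"  (infixr \<open>*\<^sub>Q\<close> 75)
  assumes scaleQ_add_right: "q *\<^sub>Q (x + y) = q *\<^sub>Q x + q *\<^sub>Q y"
    and scaleQ_add_left: "(q + r) *\<^sub>Q x = q *\<^sub>Q x + r *\<^sub>Q x"
    and scaleQ_scaleQ: "q *\<^sub>Q r *\<^sub>Q x = (q * r) *\<^sub>Q x"
    and scaleQ_one: "1 *\<^sub>Q x = x"

global_interpretation rat_vector: vector_space "scaleQ :: rat \<Rightarrow> 'a \<Rightarrow> 'a::rat_vector"
  by unfold_locales (simp_all add: scaleQ_add_right scaleQ_add_left scaleQ_scaleQ scaleQ_one)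

abbreviation qlinear :: "('a::rat_vector \<Rightarrow> 'b::rat_vector) \<Rightarrow> bool"
  where "qlinear \<equiv> Vector_Spaces.linear scaleQ scaleQ"

lemma qlinearI:
  assumes "\<And>x y. f (x + y) = f x + f y" and "\<And>q x. f (q *\<^sub>Q x) = q *\<^sub>Q f x"
  shows "qlinear f"
  by (simp add: Vector_Spaces.linear_def rat_vector.module_axioms rat_vector.vector_space_axioms
      module_hom_def module_hom_axioms_def assms)

lemma qlinearD:
  assumes "qlinear f"
  shows "f (x + y) = f x + f y" "f (q *\<^sub>Q x) = q *\<^sub>Q f x" "f 0 = 0" "f (- x) = - f x"
    "f (x - y) = f x - f y"
proof -
  interpret module_hom scaleQ scaleQ f
    using assms by (simp add: Vector_Spaces.linear_def)
  show "f (x + y) = f x + f y" "f (q *\<^sub>Q x) = q *\<^sub>Q f x" "f 0 = 0" "f (- x) = - f x"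
    "f (x - y) = f x - f y"
    by (simp_all add: add scale zero neg diff)
qed


class rat_algebra = rat_vector + ring + monoid_mult +
  assumes mult_scaleQ_left: "(q *\<^sub>Q x) * y = q *\<^sub>Q (x * y)"
    and mult_scaleQ_right: "x * (q *\<^sub>Q y) = q *\<^sub>Q (x * y)"

instantiation rat :: rat_algebra
begin
definition scaleQ_rat :: "rat \<Rightarrow> rat \<Rightarrow> rat" where "scaleQ_rat q x = q * x"
instance by standard (simp_all add: scaleQ_rat_def algebra_simps)
end

instantiation fps :: (rat_vector) rat_vector
begin
definition scaleQ_fps :: "rat \<Rightarrow> 'a fps \<Rightarrow> 'a fps"
  where "scaleQ_fps q u = Abs_fps (\<lambda>n. q *\<^sub>Q fps_nth u n)"
instance
  by standard (simp_all add: scaleQ_fps_def fps_eq_iff scaleQ_add_right scaleQ_add_left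
      scaleQ_scaleQ scaleQ_one)
end

lemma fps_nth_scaleQ [simp]: "fps_nth (q *\<^sub>Q u) n = q *\<^sub>Q fps_nth u n"
  by (simp add: scaleQ_fps_def)


section \<open>Graded Lie algebras and their derivations\<close>

class lie_algebra = rat_vector +
  fixes bracket :: "'a \<Rightarrow> 'a \<Rightarrow> 'a"
  assumes bracket_add_left: "bracket (x + y) z = bracket x z + bracket y z"
    and bracket_add_right: "bracket x (y + z) = bracket x y + bracket x z"
    and bracket_scaleQ_left: "bracket (q *\<^sub>Q x) y = q *\<^sub>Q bracket x y"
    and bracket_scaleQ_right: "bracket x (q *\<^sub>Q y) = q *\<^sub>Q bracket x y"
    and bracket_self: "bracket x x = 0"
    and jacobi: "bracket x (bracket y z) + bracket y (bracket z x) + bracket z (bracket x y) = 0"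

text \<open>The component \<open>homog n\<close> is \<open>L\<^sub>n\<close>; indexing by all naturals with \<open>L\<^sub>0 = 0\<close> encodes
  \<open>L = \<Oplus>\<^sub>n\<^sub>\<ge>\<^sub>1 L\<^sub>n\<close>.  The grading carries no Koszul signs.\<close>

class graded_lie_algebra = lie_algebra +
  fixes homog :: "nat \<Rightarrow> 'a set"
  assumes homog_zero: "0 \<in> homog n"
    and homog_add: "\<lbrakk>x \<in> homog n; y \<in> homog n\<rbrakk> \<Longrightarrow> x + y \<in> homog n"
    and homog_scaleQ: "x \<in> homog n \<Longrightarrow> q *\<^sub>Q x \<in> homog n"
    and homog_0: "homog 0 = {0}"
    and homog_decomp:
      "\<exists>!c. (\<forall>n. c n \<in> homog n) \<and> finite {n. c n \<noteq> 0} \<and> x = (\<Sum>n | c n \<noteq> 0. c n)"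
    and bracket_homog: "\<lbrakk>x \<in> homog m; y \<in> homog n\<rbrakk> \<Longrightarrow> bracket x y \<in> homog (m + n)"

definition hcomp :: "nat \<Rightarrow> 'a::graded_lie_algebra \<Rightarrow> 'a" where
  "hcomp n x =
    (THE c. (\<forall>n. c n \<in> homog n) \<and> finite {n. c n \<noteq> 0} \<and> x = (\<Sum>n | c n \<noteq> 0. c n)) n"

definition graded_lie_derivation :: "('a::graded_lie_algebra \<Rightarrow> 'a) \<Rightarrow> bool" where
  "graded_lie_derivation \<delta> \<longleftrightarrow>
    qlinear \<delta> \<and> (\<forall>x y. \<delta> (bracket x y) = bracket (\<delta> x) y + bracket x (\<delta> y)) \<and>
    (\<forall>n. \<delta> ` homog n \<subseteq> homog n)"


section \<open>Tensor products\<close>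

text \<open>\<open>V \<otimes> W\<close> as formal linear combinations of pairs modulo the least congruence containing the
  vector space axioms and bilinearity.\<close>

datatype ('a, 'b) tensor_term =
    TPure 'a 'b
  | TZero
  | TAdd "('a, 'b) tensor_term" "('a, 'b) tensor_term"
  | TNeg "('a, 'b) tensor_term"
  | TScale rat "('a, 'b) tensor_term"

inductive tensor_eq ::
  "('a::rat_vector, 'b::rat_vector) tensor_term \<Rightarrow> ('a, 'b) tensor_term \<Rightarrow> bool" where
  teq_refl: "tensor_eq s s"
| teq_sym: "tensor_eq s t \<Longrightarrow> tensor_eq t s"
| teq_trans: "tensor_eq s t \<Longrightarrow> tensor_eq t u \<Longrightarrow> tensor_eq s u"
| teq_cong_add: "tensor_eq s s' \<Longrightarrow> tensor_eq t t' \<Longrightarrow> tensor_eq (TAdd s t) (TAdd s' t')"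
| teq_cong_neg: "tensor_eq s s' \<Longrightarrow> tensor_eq (TNeg s) (TNeg s')"
| teq_cong_scale: "tensor_eq s s' \<Longrightarrow> tensor_eq (TScale q s) (TScale q s')"
| teq_add_assoc: "tensor_eq (TAdd (TAdd s t) u) (TAdd s (TAdd t u))"
| teq_add_comm: "tensor_eq (TAdd s t) (TAdd t s)"
| teq_add_zero: "tensor_eq (TAdd TZero s) s"
| teq_add_neg: "tensor_eq (TAdd (TNeg s) s) TZero"
| teq_scale_add_right: "tensor_eq (TScale q (TAdd s t)) (TAdd (TScale q s) (TScale q t))"
| teq_scale_add_left: "tensor_eq (TScale (q + r) s) (TAdd (TScale q s) (TScale r s))"
| teq_scale_scale: "tensor_eq (TScale q (TScale r s)) (TScale (q * r) s)"
| teq_scale_one: "tensor_eq (TScale 1 s) s"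
| teq_pure_add_left: "tensor_eq (TPure (a + a') b) (TAdd (TPure a b) (TPure a' b))"
| teq_pure_add_right: "tensor_eq (TPure a (b + b')) (TAdd (TPure a b) (TPure a b'))"
| teq_pure_scale_left: "tensor_eq (TPure (q *\<^sub>Q a) b) (TScale q (TPure a b))"
| teq_pure_scale_right: "tensor_eq (TPure a (q *\<^sub>Q b)) (TScale q (TPure a b))"

lemmas tensor_axioms =
  teq_refl teq_add_assoc teq_add_comm teq_add_zero teq_add_neg
  teq_scale_add_right teq_scale_add_left teq_scale_scale teq_scale_one
  teq_pure_add_left teq_pure_add_right teq_pure_scale_left teq_pure_scale_right

quotient_type (overloaded) ('a, 'b) tensor =
  "('a::rat_vector, 'b::rat_vector) tensor_term" / tensor_eq
  by (auto intro!: equivpI reflpI sympI transpI intro: teq_refl teq_sym teq_trans)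

instantiation tensor :: (rat_vector, rat_vector) rat_vector
begin
lift_definition zero_tensor :: "('a, 'b) tensor" is TZero .
lift_definition plus_tensor :: "('a, 'b) tensor \<Rightarrow> ('a, 'b) tensor \<Rightarrow> ('a, 'b) tensor" is TAdd
  by (rule teq_cong_add)
lift_definition uminus_tensor :: "('a, 'b) tensor \<Rightarrow> ('a, 'b) tensor" is TNeg
  by (rule teq_cong_neg)
lift_definition minus_tensor :: "('a, 'b) tensor \<Rightarrow> ('a, 'b) tensor \<Rightarrow> ('a, 'b) tensor"
  is "\<lambda>s t. TAdd s (TNeg t)"
  by (intro teq_cong_add teq_cong_neg)
lift_definition scaleQ_tensor :: "rat \<Rightarrow> ('a, 'b) tensor \<Rightarrow> ('a, 'b) tensor" is TScale
  by (rule teq_cong_scale)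
instance
  by standard (transfer; rule tensor_axioms)+
end

lift_definition pure_tensor :: "'a::rat_vector \<Rightarrow> 'b::rat_vector \<Rightarrow> ('a, 'b) tensor"
  (infixr \<open>\<otimes>\<^sub>t\<close> 71) is TPure .

lemma pure_tensor_bilinear:
  "(a + a') \<otimes>\<^sub>t b = a \<otimes>\<^sub>t b + a' \<otimes>\<^sub>t b"
  "a \<otimes>\<^sub>t (b + b') = a \<otimes>\<^sub>t b + a \<otimes>\<^sub>t b'"
  "(q *\<^sub>Q a) \<otimes>\<^sub>t b = q *\<^sub>Q (a \<otimes>\<^sub>t b)"
  "a \<otimes>\<^sub>t (q *\<^sub>Q b) = q *\<^sub>Q (a \<otimes>\<^sub>t b)"
  by (transfer; rule tensor_axioms)+

lemma tensor_induct [case_names pure add]: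
  assumes pure: "\<And>a b. P (a \<otimes>\<^sub>t b)" and add: "\<And>s t. P s \<Longrightarrow> P t \<Longrightarrow> P (s + t)"
  shows "P t"
proof -
  have "(0 :: 'a) \<otimes>\<^sub>t (0 :: 'b) = 0"
    using pure_tensor_bilinear(1)[of 0 0 0] by simp
  then have zero: "P 0"
    using pure[of 0 0] by (simp only:)
  have scale: "P (q *\<^sub>Q abs_tensor t)" for q t
  proof (induction t arbitrary: q)
    case (TPure a b)
    have "q *\<^sub>Q abs_tensor (TPure a b) = (q *\<^sub>Q a) \<otimes>\<^sub>t b"
      by (simp add: pure_tensor_bilinear flip: pure_tensor.abs_eq)
    then show ?case using pure by simp
  next
    case TZero
    then show ?case using zero by (simp flip: zero_tensor_def)
  next
    case (TAdd s t)
    then show ?case using add by (simp add: scaleQ_add_right flip: plus_tensor.abs_eq)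
  next
    case (TNeg t)
    have "q *\<^sub>Q abs_tensor (TNeg t) = (- q) *\<^sub>Q abs_tensor t"
      by (simp flip: uminus_tensor.abs_eq)
    then show ?case using TNeg[of "- q"] by (simp only:)
  next
    case (TScale r t)
    have "q *\<^sub>Q abs_tensor (TScale r t) = (q * r) *\<^sub>Q abs_tensor t"
      by (simp flip: scaleQ_tensor.abs_eq add: scaleQ_scaleQ)
    then show ?case using TScale by simp
  qed
  show ?thesis
    using scale[of 1 "rep_tensor t"]
    by (simp add: scaleQ_one Quotient_abs_rep[OF Quotient_tensor])
qed

definition qbilinear :: "('a::rat_vector \<Rightarrow> 'b::rat_vector \<Rightarrow> 'c::rat_vector) \<Rightarrow> bool" where
  "qbilinear h \<longleftrightarrow> (\<forall>a. qlinear (h a)) \<and> (\<forall>b. qlinear (\<lambda>a. h a b))"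

lemma qbilinearI:
  assumes "\<And>a b b'. h a (b + b') = h a b + h a b'" "\<And>a b q. h a (q *\<^sub>Q b) = q *\<^sub>Q h a b"
    "\<And>a a' b. h (a + a') b = h a b + h a' b" "\<And>a b q. h (q *\<^sub>Q a) b = q *\<^sub>Q h a b"
  shows "qbilinear h"
  unfolding qbilinear_def by (auto intro!: qlinearI simp: assms)

lemma qbilinearD:
  assumes "qbilinear h"
  shows "h a (b + b') = h a b + h a b'" "h a (q *\<^sub>Q b) = q *\<^sub>Q h a b"
    "h (a + a') b = h a b + h a' b" "h (q *\<^sub>Q a) b = q *\<^sub>Q h a b"
  using assms qlinearD(1,2)[of "h a"] qlinearD(1,2)[of "\<lambda>a. h a b"]
  by (simp_all add: qbilinear_def)

primrec tensor_eval ::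
  "('a \<Rightarrow> 'b \<Rightarrow> 'c::rat_vector) \<Rightarrow> ('a, 'b) tensor_term \<Rightarrow> 'c" where
  "tensor_eval h (TPure a b) = h a b"
| "tensor_eval h TZero = 0"
| "tensor_eval h (TAdd s t) = tensor_eval h s + tensor_eval h t"
| "tensor_eval h (TNeg s) = - tensor_eval h s"
| "tensor_eval h (TScale q s) = q *\<^sub>Q tensor_eval h s"

lemma tensor_eval_cong:
  assumes "qbilinear h" and "tensor_eq s t"
  shows "tensor_eval h s = tensor_eval h t"
  using assms(2)
proof induction
qed (simp_all add: qbilinearD[OF assms(1)] scaleQ_add_right scaleQ_add_left scaleQ_scaleQ
    scaleQ_one add_ac)

text \<open>The linear map induced by \<open>h\<close>; independent of the choice of representative
  only for bilinear \<open>h\<close>.\<close>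

definition tensor_lift ::
  "('a::rat_vector \<Rightarrow> 'b::rat_vector \<Rightarrow> 'c::rat_vector) \<Rightarrow> ('a, 'b) tensor \<Rightarrow> 'c" where
  "tensor_lift h t = tensor_eval h (rep_tensor t)"

lemma tensor_lift:
  assumes "qbilinear h"
  shows tensor_lift_pure: "tensor_lift h (a \<otimes>\<^sub>t b) = h a b"
    and tensor_lift_linear: "qlinear (tensor_lift h)"
proof -
  have abs: "tensor_lift h (abs_tensor t) = tensor_eval h t" for t
    unfolding tensor_lift_def
    by (rule tensor_eval_cong[OF assms], rule Quotient_rep_abs[OF Quotient_tensor])
      (rule teq_refl)
  show "tensor_lift h (a \<otimes>\<^sub>t b) = h a b"
    by (simp add: pure_tensor.abs_eq abs)
  show "qlinear (tensor_lift h)"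
  proof (rule qlinearI)
    fix s t :: "('a, 'b) tensor" and q
    obtain s' t' where st: "s = abs_tensor s'" "t = abs_tensor t'"
      by (metis Quotient_abs_rep[OF Quotient_tensor])
    show "tensor_lift h (s + t) = tensor_lift h s + tensor_lift h t"
      by (simp add: st plus_tensor.abs_eq abs)
    show "tensor_lift h (q *\<^sub>Q s) = q *\<^sub>Q tensor_lift h s"
      by (simp add: st scaleQ_tensor.abs_eq abs)
  qed
qed

definition tensor_map ::
  "('a::rat_vector \<Rightarrow> 'c::rat_vector) \<Rightarrow> ('b::rat_vector \<Rightarrow> 'd::rat_vector) \<Rightarrow>
    ('a, 'b) tensor \<Rightarrow> ('c, 'd) tensor" where
  "tensor_map f g = tensor_lift (\<lambda>a b. f a \<otimes>\<^sub>t g b)"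

lemma tensor_map:
  assumes "qlinear f" "qlinear g"
  shows tensor_map_pure: "tensor_map f g (a \<otimes>\<^sub>t b) = f a \<otimes>\<^sub>t g b"
    and tensor_map_linear: "qlinear (tensor_map f g)"
proof -
  have "qbilinear (\<lambda>a b. f a \<otimes>\<^sub>t g b)"
    by (rule qbilinearI) (simp_all add: qlinearD[OF assms(1)] qlinearD[OF assms(2)] pure_tensor_bilinear)
  then show "tensor_map f g (a \<otimes>\<^sub>t b) = f a \<otimes>\<^sub>t g b" "qlinear (tensor_map f g)"
    by (simp_all add: tensor_map_def tensor_lift)
qed

definition tensor_left_mult ::
  "'a::rat_algebra \<Rightarrow> 'b::rat_algebra \<Rightarrow> ('a, 'b) tensor \<Rightarrow> ('a, 'b) tensor" where
  "tensor_left_mult a b = tensor_lift (\<lambda>c d. (a * c) \<otimes>\<^sub>t (b * d))"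

lemma tensor_left_mult:
  shows tensor_left_mult_pure: "tensor_left_mult a b (c \<otimes>\<^sub>t d) = (a * c) \<otimes>\<^sub>t (b * d)"
    and tensor_left_mult_linear: "qlinear (tensor_left_mult a b)"
proof -
  have "qbilinear (\<lambda>c d. (a * c) \<otimes>\<^sub>t (b * d))"
    by (rule qbilinearI)
      (simp_all add: pure_tensor_bilinear distrib_left mult_scaleQ_right)
  then show "tensor_left_mult a b (c \<otimes>\<^sub>t d) = (a * c) \<otimes>\<^sub>t (b * d)"
      "qlinear (tensor_left_mult a b)"
    by (simp_all add: tensor_left_mult_def tensor_lift)
qed

lemma tensor_left_mult_bilinear: "qbilinear (\<lambda>a b. tensor_left_mult a b t)"
proof (rule qbilinearI)
  fix a a' :: 'a and b b' :: 'b and q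
  note simps = tensor_left_mult_pure qlinearD(1)[OF tensor_left_mult_linear]
    pure_tensor_bilinear distrib_right mult_scaleQ_left scaleQ_add_right
  show "tensor_left_mult a (b + b') t = tensor_left_mult a b t + tensor_left_mult a b' t"
    by (induction t rule: tensor_induct) (simp_all add: simps)
  show "tensor_left_mult a (q *\<^sub>Q b) t = q *\<^sub>Q tensor_left_mult a b t"
    by (induction t rule: tensor_induct) (simp_all add: simps)
  show "tensor_left_mult (a + a') b t = tensor_left_mult a b t + tensor_left_mult a' b t"
    by (induction t rule: tensor_induct) (simp_all add: simps)
  show "tensor_left_mult (q *\<^sub>Q a) b t = q *\<^sub>Q tensor_left_mult a b t"
    by (induction t rule: tensor_induct) (simp_all add: simps)
qed

instantiation tensor :: (rat_algebra, rat_algebra) rat_algebra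
begin

definition one_tensor :: "('a, 'b) tensor" where "one_tensor = 1 \<otimes>\<^sub>t 1"

text \<open>This is the linear extension of \<open>(a \<otimes> b) (c \<otimes> d) = a c \<otimes> b d\<close>.\<close>

definition times_tensor :: "('a, 'b) tensor \<Rightarrow> ('a, 'b) tensor \<Rightarrow> ('a, 'b) tensor" where
  "times_tensor s t = tensor_lift (\<lambda>a b. tensor_left_mult a b t) s"

instance
proof
  note lin = tensor_lift_linear[OF tensor_left_mult_bilinear]
  fix s t u :: "('a, 'b) tensor" and q
  have left: "(a \<otimes>\<^sub>t b) * t = tensor_left_mult a b t" for a b and t :: "('a, 'b) tensor"
    by (simp add: times_tensor_def tensor_lift_pure[OF tensor_left_mult_bilinear])
  have pure: "(a \<otimes>\<^sub>t b) * (c \<otimes>\<^sub>t d) = (a * c) \<otimes>\<^sub>t (b * d)" for a c :: 'a and b d :: 'b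
    by (simp add: left tensor_left_mult_pure)
  have dr: "(s + t) * u = s * u + t * u" for s t u :: "('a, 'b) tensor"
    by (simp add: times_tensor_def qlinearD(1)[OF lin])
  have dl: "s * (t + u) = s * t + s * u" for s t u :: "('a, 'b) tensor"
    by (induction s rule: tensor_induct)
      (simp_all add: left dr qlinearD(1)[OF tensor_left_mult_linear] add_ac)
  show "s * (t + u) = s * t + s * u" by (rule dl)
  show "(s + t) * u = s * u + t * u" by (rule dr)
  have 1: "((a \<otimes>\<^sub>t b) * (c \<otimes>\<^sub>t d)) * u = (a \<otimes>\<^sub>t b) * ((c \<otimes>\<^sub>t d) * u)"
    for a c :: 'a and b d :: 'b
    by (induction u rule: tensor_induct) (simp_all add: pure dl mult.assoc)
  have 2: "((a \<otimes>\<^sub>t b) * t) * u = (a \<otimes>\<^sub>t b) * (t * u)" for a b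
    by (induction t rule: tensor_induct) (simp_all add: 1 dl dr)
  show "s * t * u = s * (t * u)"
    by (induction s rule: tensor_induct) (simp_all add: 2 dr)
  show "1 * s = s"
    by (induction s rule: tensor_induct) (simp_all add: one_tensor_def pure dl)
  show "s * 1 = s"
    by (induction s rule: tensor_induct) (simp_all add: one_tensor_def pure dr)
  show "(q *\<^sub>Q s) * t = q *\<^sub>Q (s * t)"
    by (simp add: times_tensor_def qlinearD(2)[OF lin])
  show "s * (q *\<^sub>Q t) = q *\<^sub>Q (s * t)"
    by (induction s rule: tensor_induct)
      (simp_all add: left dr qlinearD(2)[OF tensor_left_mult_linear] scaleQ_add_right)
qed

end

lemma times_tensor_pure: "(a \<otimes>\<^sub>t b) * (c \<otimes>\<^sub>t d) = (a * c) \<otimes>\<^sub>t (b * d)"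
  unfolding times_tensor_def tensor_lift_pure[OF tensor_left_mult_bilinear]
  by (rule tensor_left_mult_pure)

definition mult_map :: "('a::rat_algebra, 'a) tensor \<Rightarrow> 'a"
  where "mult_map = tensor_lift (*)"

lemma mult_map:
  fixes a b :: "'a::rat_algebra"
  shows mult_map_pure: "mult_map (a \<otimes>\<^sub>t b) = a * b"
    and mult_map_linear: "qlinear (mult_map :: ('a, 'a) tensor \<Rightarrow> 'a)"
proof -
  have "qbilinear ((*) :: 'a \<Rightarrow> 'a \<Rightarrow> 'a)"
    by (rule qbilinearI) (simp_all add: algebra_simps mult_scaleQ_left mult_scaleQ_right)
  then show "mult_map (a \<otimes>\<^sub>t b) = a * b" "qlinear (mult_map :: ('a, 'a) tensor \<Rightarrow> 'a)"
    by (simp_all add: mult_map_def tensor_lift)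
qed


section \<open>The universal enveloping algebra\<close>

text \<open>\<open>U(L)\<close> is the unital associative \<open>\<rat>\<close>-algebra presented by the generators \<open>x \<in> L\<close>, subject
  to linearity of \<open>x \<mapsto> Gen x\<close> and \<open>[x, y] = x y - y x\<close>: algebra terms modulo the least congruence
  containing the algebra axioms and these relations.  Lemmas \<open>ua_lift_hom\<close> and \<open>ua_hom_unique\<close>
  below give its universal property.\<close>

datatype 'a ua_term =
    Gen 'a
  | UZero
  | UOne
  | UAdd "'a ua_term" "'a ua_term"
  | UNeg "'a ua_term"
  | UMul "'a ua_term" "'a ua_term"
  | UScale rat "'a ua_term"

inductive ua_eq :: "'a::lie_algebra ua_term \<Rightarrow> 'a ua_term \<Rightarrow> bool" where
  ueq_refl: "ua_eq s s"
| ueq_sym: "ua_eq s t \<Longrightarrow> ua_eq t s"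
| ueq_trans: "ua_eq s t \<Longrightarrow> ua_eq t u \<Longrightarrow> ua_eq s u"
| ueq_cong_add: "ua_eq s s' \<Longrightarrow> ua_eq t t' \<Longrightarrow> ua_eq (UAdd s t) (UAdd s' t')"
| ueq_cong_neg: "ua_eq s s' \<Longrightarrow> ua_eq (UNeg s) (UNeg s')"
| ueq_cong_mul: "ua_eq s s' \<Longrightarrow> ua_eq t t' \<Longrightarrow> ua_eq (UMul s t) (UMul s' t')"
| ueq_cong_scale: "ua_eq s s' \<Longrightarrow> ua_eq (UScale q s) (UScale q s')"
| ueq_add_assoc: "ua_eq (UAdd (UAdd s t) u) (UAdd s (UAdd t u))"
| ueq_add_comm: "ua_eq (UAdd s t) (UAdd t s)"
| ueq_add_zero: "ua_eq (UAdd UZero s) s"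
| ueq_add_neg: "ua_eq (UAdd (UNeg s) s) UZero"
| ueq_mul_assoc: "ua_eq (UMul (UMul s t) u) (UMul s (UMul t u))"
| ueq_mul_one_left: "ua_eq (UMul UOne s) s"
| ueq_mul_one_right: "ua_eq (UMul s UOne) s"
| ueq_distrib_right: "ua_eq (UMul (UAdd s t) u) (UAdd (UMul s u) (UMul t u))"
| ueq_distrib_left: "ua_eq (UMul s (UAdd t u)) (UAdd (UMul s t) (UMul s u))"
| ueq_scale_add_right: "ua_eq (UScale q (UAdd s t)) (UAdd (UScale q s) (UScale q t))"
| ueq_scale_add_left: "ua_eq (UScale (q + r) s) (UAdd (UScale q s) (UScale r s))"
| ueq_scale_scale: "ua_eq (UScale q (UScale r s)) (UScale (q * r) s)"
| ueq_scale_one: "ua_eq (UScale 1 s) s"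
| ueq_mul_scale_left: "ua_eq (UMul (UScale q s) t) (UScale q (UMul s t))"
| ueq_mul_scale_right: "ua_eq (UMul s (UScale q t)) (UScale q (UMul s t))"
| ueq_gen_add: "ua_eq (Gen (x + y)) (UAdd (Gen x) (Gen y))"
| ueq_gen_scale: "ua_eq (Gen (q *\<^sub>Q x)) (UScale q (Gen x))"
| ueq_gen_bracket:
    "ua_eq (Gen (bracket x y)) (UAdd (UMul (Gen x) (Gen y)) (UNeg (UMul (Gen y) (Gen x))))"

lemmas ua_axioms =
  ueq_refl ueq_add_assoc ueq_add_comm ueq_add_zero ueq_add_neg ueq_mul_assoc
  ueq_mul_one_left ueq_mul_one_right ueq_distrib_right ueq_distrib_left
  ueq_scale_add_right ueq_scale_add_left ueq_scale_scale ueq_scale_one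
  ueq_mul_scale_left ueq_mul_scale_right ueq_gen_add ueq_gen_scale ueq_gen_bracket

quotient_type (overloaded) 'a ua = "'a::lie_algebra ua_term" / ua_eq
  by (auto intro!: equivpI reflpI sympI transpI intro: ueq_refl ueq_sym ueq_trans)

primrec ua_eval :: "('a \<Rightarrow> 'b::rat_algebra) \<Rightarrow> 'a ua_term \<Rightarrow> 'b" where
  "ua_eval f (Gen x) = f x"
| "ua_eval f UZero = 0"
| "ua_eval f UOne = 1"
| "ua_eval f (UAdd s t) = ua_eval f s + ua_eval f t"
| "ua_eval f (UNeg s) = - ua_eval f s"
| "ua_eval f (UMul s t) = ua_eval f s * ua_eval f t"
| "ua_eval f (UScale q s) = q *\<^sub>Q ua_eval f s"

definition lie_hom :: "('a::lie_algebra \<Rightarrow> 'b::rat_algebra) \<Rightarrow> bool" where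
  "lie_hom f \<longleftrightarrow> qlinear f \<and> (\<forall>x y. f (bracket x y) = f x * f y - f y * f x)"

lemma ua_eval_cong:
  assumes "lie_hom f" and "ua_eq s t"
  shows "ua_eval f s = ua_eval f t"
  using assms(2)
proof induction
qed (use assms(1) in \<open>simp_all add: lie_hom_def qlinearD algebra_simps scaleQ_add_right
    scaleQ_add_left scaleQ_scaleQ scaleQ_one mult_scaleQ_left mult_scaleQ_right\<close>)

instantiation ua :: (lie_algebra) ring_1
begin
lift_definition zero_ua :: "'a ua" is UZero .
lift_definition one_ua :: "'a ua" is UOne .
lift_definition plus_ua :: "'a ua \<Rightarrow> 'a ua \<Rightarrow> 'a ua" is UAdd
  by (rule ueq_cong_add)
lift_definition uminus_ua :: "'a ua \<Rightarrow> 'a ua" is UNeg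
  by (rule ueq_cong_neg)
lift_definition minus_ua :: "'a ua \<Rightarrow> 'a ua \<Rightarrow> 'a ua" is "\<lambda>s t. UAdd s (UNeg t)"
  by (intro ueq_cong_add ueq_cong_neg)
lift_definition times_ua :: "'a ua \<Rightarrow> 'a ua \<Rightarrow> 'a ua" is UMul
  by (rule ueq_cong_mul)
instance
proof
  show "(0 :: 'a ua) \<noteq> 1"
  proof (transfer, rule notI)
    assume "ua_eq (UZero :: 'a ua_term) UOne"
    moreover have "lie_hom (\<lambda>_ :: 'a. 0 :: rat)"
      by (auto simp: lie_hom_def intro!: qlinearI)
    ultimately have "ua_eval (\<lambda>_. 0 :: rat) (UZero :: 'a ua_term) = ua_eval (\<lambda>_. 0) (UOne :: 'a ua_term)"
      by (rule ua_eval_cong[rotated])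
    then show False by simp
  qed
qed (transfer; rule ua_axioms)+
end

instantiation ua :: (lie_algebra) rat_algebra
begin
lift_definition scaleQ_ua :: "rat \<Rightarrow> 'a ua \<Rightarrow> 'a ua" is UScale
  by (rule ueq_cong_scale)
instance
  by standard (transfer; rule ua_axioms)+
end

lift_definition ua_gen :: "'a::lie_algebra \<Rightarrow> 'a ua" (\<open>\<iota>\<close>) is Gen .

lemma ua_gen_linear: "qlinear \<iota>"
  by (rule qlinearI; transfer) (rule ua_axioms)+

lemma ua_gen_bracket: "\<iota> (bracket x y) = \<iota> x * \<iota> y - \<iota> y * \<iota> x"
  by transfer (rule ueq_gen_bracket)

lemma ua_induct [case_names gen one add mult scale]:
  assumes "\<And>x. P (\<iota> x)" "P 1" "\<And>u v. P u \<Longrightarrow> P v \<Longrightarrow> P (u + v)"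
    "\<And>u v. P u \<Longrightarrow> P v \<Longrightarrow> P (u * v)" "\<And>q u. P u \<Longrightarrow> P (q *\<^sub>Q u)"
  shows "P u"
proof -
  have "P (abs_ua t)" for t
  proof (induction t)
    case UZero
    show ?case using assms(5)[OF assms(2), of 0] by (simp add: zero_ua_def)
  next
    case (UNeg t)
    show ?case using assms(5)[OF UNeg, of "- 1"] by (simp flip: uminus_ua.abs_eq)
  qed (use assms in \<open>simp_all flip: ua_gen.abs_eq one_ua_def plus_ua.abs_eq times_ua.abs_eq
      scaleQ_ua.abs_eq\<close>)
  then show ?thesis by (metis Quotient_abs_rep[OF Quotient_ua])
qed

definition algebra_hom :: "('a::rat_algebra \<Rightarrow> 'b::rat_algebra) \<Rightarrow> bool" where
  "algebra_hom f \<longleftrightarrow> qlinear f \<and> f 1 = 1 \<and> (\<forall>u v. f (u * v) = f u * f v)"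

text \<open>The algebra homomorphism induced by \<open>f\<close>; meaningful only if \<open>lie_hom f\<close>.\<close>

definition ua_lift :: "('a::lie_algebra \<Rightarrow> 'b::rat_algebra) \<Rightarrow> 'a ua \<Rightarrow> 'b" where
  "ua_lift f u = ua_eval f (rep_ua u)"

lemma ua_lift:
  assumes "lie_hom f"
  shows ua_lift_gen: "ua_lift f (\<iota> x) = f x"
    and ua_lift_hom: "algebra_hom (ua_lift f)"
proof -
  have abs: "ua_lift f (abs_ua t) = ua_eval f t" for t
    unfolding ua_lift_def
    by (rule ua_eval_cong[OF assms], rule Quotient_rep_abs[OF Quotient_ua]) (rule ueq_refl)
  have surj: "\<exists>t. u = abs_ua t" for u :: "'a ua"
    by (metis Quotient_abs_rep[OF Quotient_ua])
  show "ua_lift f (\<iota> x) = f x"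
    by (simp add: ua_gen.abs_eq abs)
  have "ua_lift f (u + v) = ua_lift f u + ua_lift f v"
    and "ua_lift f (q *\<^sub>Q u) = q *\<^sub>Q ua_lift f u"
    and "ua_lift f (u * v) = ua_lift f u * ua_lift f v" for u v q
    using surj[of u] surj[of v]
    by (auto simp: plus_ua.abs_eq scaleQ_ua.abs_eq times_ua.abs_eq abs)
  moreover have "ua_lift f 1 = 1"
    by (simp add: one_ua_def abs)
  ultimately show "algebra_hom (ua_lift f)"
    by (auto simp: algebra_hom_def intro: qlinearI)
qed

lemma ua_hom_unique:
  assumes "algebra_hom f" "algebra_hom g" "\<And>x. f (\<iota> x) = g (\<iota> x)"
  shows "f = g"
proof
  show "f u = g u" for u
    by (induction u rule: ua_induct) (use assms in \<open>simp_all add: algebra_hom_def qlinearD\<close>)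
qed


section \<open>Hopf structure and convolution\<close>

definition coproduct :: "'a::lie_algebra ua \<Rightarrow> ('a ua, 'a ua) tensor" where
  "coproduct = ua_lift (\<lambda>x. \<iota> x \<otimes>\<^sub>t 1 + 1 \<otimes>\<^sub>t \<iota> x)"

lemma coproduct:
  fixes x :: "'a::lie_algebra"
  shows coproduct_gen: "coproduct (\<iota> x) = \<iota> x \<otimes>\<^sub>t 1 + 1 \<otimes>\<^sub>t \<iota> x"
    and coproduct_hom: "algebra_hom (coproduct :: 'a ua \<Rightarrow> _)"
proof -
  have diff: "(a - a') \<otimes>\<^sub>t b = a \<otimes>\<^sub>t b - a' \<otimes>\<^sub>t b" "b \<otimes>\<^sub>t (a - a') = b \<otimes>\<^sub>t a - b \<otimes>\<^sub>t a'"
    for a a' b :: "'a ua"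
    using pure_tensor_bilinear(1)[of "a - a'" a' b] pure_tensor_bilinear(2)[of b "a - a'" a']
    by (simp_all add: algebra_simps)
  have "lie_hom (\<lambda>x :: 'a. \<iota> x \<otimes>\<^sub>t (1 :: 'a ua) + (1 :: 'a ua) \<otimes>\<^sub>t \<iota> x)"
    unfolding lie_hom_def
  proof (intro conjI allI)
    show "qlinear (\<lambda>x :: 'a. \<iota> x \<otimes>\<^sub>t (1 :: 'a ua) + (1 :: 'a ua) \<otimes>\<^sub>t \<iota> x)"
      by (rule qlinearI) (simp_all add: qlinearD[OF ua_gen_linear] pure_tensor_bilinear
          scaleQ_add_right add_ac)
  qed (simp add: ua_gen_bracket distrib_left distrib_right times_tensor_pure diff)
  then show "coproduct (\<iota> x) = \<iota> x \<otimes>\<^sub>t 1 + 1 \<otimes>\<^sub>t \<iota> x"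
      "algebra_hom (coproduct :: 'a ua \<Rightarrow> _)"
    by (simp_all add: coproduct_def ua_lift)
qed

definition counit :: "'a::lie_algebra ua \<Rightarrow> rat"
  where "counit = ua_lift (\<lambda>_. 0)"

lemma counit:
  fixes x :: "'a::lie_algebra"
  shows counit_gen: "counit (\<iota> x) = 0"
    and counit_hom: "algebra_hom (counit :: 'a ua \<Rightarrow> _)"
proof -
  have "lie_hom (\<lambda>_ :: 'a. 0 :: rat)"
    by (auto simp: lie_hom_def intro!: qlinearI)
  then show "counit (\<iota> x) = 0" "algebra_hom (counit :: 'a ua \<Rightarrow> _)"
    by (simp_all add: counit_def ua_lift)
qed

primrec antipode_term :: "'a::lie_algebra ua_term \<Rightarrow> 'a ua" where
  "antipode_term (Gen x) = - \<iota> x"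
| "antipode_term UZero = 0"
| "antipode_term UOne = 1"
| "antipode_term (UAdd s t) = antipode_term s + antipode_term t"
| "antipode_term (UNeg s) = - antipode_term s"
| "antipode_term (UMul s t) = antipode_term t * antipode_term s"
| "antipode_term (UScale q s) = q *\<^sub>Q antipode_term s"

text \<open>The anti-automorphism with \<open>\<iota> x \<mapsto> - \<iota> x\<close>; by \<open>antipode_convolution\<close> below it is the
  convolution inverse of the identity.\<close>

lift_definition antipode :: "'a::lie_algebra ua \<Rightarrow> 'a ua" is antipode_term
proof -
  fix s t :: "'a ua_term"
  assume "ua_eq s t"
  then show "antipode_term s = antipode_term t"
    by induction (simp_all add: algebra_simps scaleQ_add_right scaleQ_add_left scaleQ_scaleQ
        scaleQ_one mult_scaleQ_left mult_scaleQ_right qlinearD[OF ua_gen_linear] ua_gen_bracket)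
qed

lemma antipode:
  shows antipode_gen: "antipode (\<iota> x) = - \<iota> x"
    and antipode_one: "antipode 1 = 1"
    and antipode_mult: "antipode (u * v) = antipode v * antipode u"
    and antipode_linear: "qlinear antipode"
  by (transfer; simp)+ (rule qlinearI; transfer; simp)

definition convolution ::
  "('a::lie_algebra ua \<Rightarrow> 'a ua) \<Rightarrow> ('a ua \<Rightarrow> 'a ua) \<Rightarrow> 'a ua \<Rightarrow> 'a ua"  (infixl \<open>\<star>\<close> 70) where
  "f \<star> g = mult_map \<circ> tensor_map f g \<circ> coproduct"

lemma convolution_linear:
  assumes "qlinear f" "qlinear g"
  shows "qlinear (f \<star> g)"
  by (rule qlinearI)
    (simp_all add: convolution_def qlinearD[OF mult_map_linear] qlinearD[OF tensor_map_linear[OF assms]]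
      qlinearD[OF conjunct1[OF coproduct_hom[unfolded algebra_hom_def]]])

lemma antipode_convolution:
  "antipode \<star> id = (\<lambda>u :: 'a::lie_algebra ua. counit u *\<^sub>Q 1)"
  "id \<star> antipode = (\<lambda>u :: 'a ua. counit u *\<^sub>Q 1)"
proof -
  note lin_id = qlinearI[of "id :: 'a ua \<Rightarrow> 'a ua", simplified]
  note hom = coproduct_hom[unfolded algebra_hom_def] counit_hom[unfolded algebra_hom_def]
  define \<phi> where "\<phi> T = mult_map (tensor_map antipode (id :: 'a ua \<Rightarrow> 'a ua) T)" for T
  define \<psi> where "\<psi> T = mult_map (tensor_map (id :: 'a ua \<Rightarrow> 'a ua) antipode T)" for T
  have \<phi>_lin: "qlinear \<phi>" and \<psi>_lin: "qlinear \<psi>"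
    by (rule qlinearI; simp add: \<phi>_def \<psi>_def qlinearD[OF mult_map_linear]
        qlinearD[OF tensor_map_linear[OF antipode_linear lin_id]]
        qlinearD[OF tensor_map_linear[OF lin_id antipode_linear]])+
  have \<phi>_pure: "\<phi> (a \<otimes>\<^sub>t b) = antipode a * b" and \<psi>_pure: "\<psi> (a \<otimes>\<^sub>t b) = a * antipode b" for a b
    by (simp_all add: \<phi>_def \<psi>_def tensor_map_pure antipode_linear lin_id mult_map_pure)
  have gen_pure: "\<phi> (coproduct (\<iota> x) * (a \<otimes>\<^sub>t b)) = 0" "\<psi> ((a \<otimes>\<^sub>t b) * coproduct (\<iota> x)) = 0" for x a b
    by (simp_all add: coproduct_gen distrib_left distrib_right times_tensor_pure qlinearD[OF \<phi>_lin]
        qlinearD[OF \<psi>_lin] \<phi>_pure \<psi>_pure antipode_mult antipode_gen mult.assoc)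
  have gen: "\<phi> (coproduct (\<iota> x) * T) = 0" "\<psi> (T * coproduct (\<iota> x)) = 0" for x T
    by (induction T rule: tensor_induct)
      (simp_all add: gen_pure distrib_left distrib_right qlinearD[OF \<phi>_lin] qlinearD[OF \<psi>_lin])
  have \<phi>: "\<phi> (coproduct u * T) = counit u *\<^sub>Q \<phi> T" for u T
    by (induction u arbitrary: T rule: ua_induct)
      (simp_all add: gen counit_gen hom qlinearD[OF conjunct1[OF hom(1)]]
        qlinearD[OF conjunct1[OF hom(2)]] qlinearD[OF \<phi>_lin] scaleQ_one distrib_right
        scaleQ_add_left scaleQ_scaleQ mult_scaleQ_left mult.assoc scaleQ_rat_def)
  have \<psi>: "\<psi> (T * coproduct u) = counit u *\<^sub>Q \<psi> T" for u T
    by (induction u arbitrary: T rule: ua_induct)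
      (simp_all add: gen counit_gen hom qlinearD[OF conjunct1[OF hom(1)]]
        qlinearD[OF conjunct1[OF hom(2)]] qlinearD[OF \<psi>_lin] scaleQ_one distrib_left
        scaleQ_add_left scaleQ_scaleQ mult_scaleQ_right mult.commute[of "_ :: rat"] scaleQ_rat_def
        flip: mult.assoc)
  have "\<phi> 1 = 1" "\<psi> 1 = 1"
    by (simp_all add: one_tensor_def \<phi>_pure \<psi>_pure antipode_one)
  then show "antipode \<star> id = (\<lambda>u :: 'a ua. counit u *\<^sub>Q 1)"
      "id \<star> antipode = (\<lambda>u :: 'a ua. counit u *\<^sub>Q 1)"
    using \<phi>[of _ 1] \<psi>[of 1] by (simp_all add: fun_eq_iff convolution_def \<phi>_def \<psi>_def)
qed

definition derivation :: "('a::rat_algebra \<Rightarrow> 'a) \<Rightarrow> bool" where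
  "derivation D \<longleftrightarrow> qlinear D \<and> (\<forall>u v. D (u * v) = D u * v + u * D v)"

definition extend_derivation :: "('a::lie_algebra \<Rightarrow> 'a) \<Rightarrow> 'a ua \<Rightarrow> 'a ua" where
  "extend_derivation \<delta> = (THE D. derivation D \<and> (\<forall>x. D (\<iota> x) = \<iota> (\<delta> x)))"

primrec derivation_term :: "('a::lie_algebra \<Rightarrow> 'a) \<Rightarrow> 'a ua_term \<Rightarrow> 'a ua" where
  "derivation_term \<delta> (Gen x) = \<iota> (\<delta> x)"
| "derivation_term \<delta> UZero = 0"
| "derivation_term \<delta> UOne = 0"
| "derivation_term \<delta> (UAdd s t) = derivation_term \<delta> s + derivation_term \<delta> t"
| "derivation_term \<delta> (UNeg s) = - derivation_term \<delta> s"
| "derivation_term \<delta> (UMul s t) = derivation_term \<delta> s * abs_ua t + abs_ua s * derivation_term \<delta> t"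
| "derivation_term \<delta> (UScale q s) = q *\<^sub>Q derivation_term \<delta> s"

lemma ex1_extend_derivation:
  assumes "qlinear \<delta>" "\<And>x y. \<delta> (bracket x y) = bracket (\<delta> x) y + bracket x (\<delta> y)"
  shows "\<exists>!D. derivation D \<and> (\<forall>x. D (\<iota> x) = \<iota> (\<delta> x))"
proof (rule ex_ex1I)
  note abs_simps = plus_ua.abs_eq[symmetric] times_ua.abs_eq[symmetric] uminus_ua.abs_eq[symmetric]
    scaleQ_ua.abs_eq[symmetric] ua_gen.abs_eq[symmetric] one_ua_def[symmetric] zero_ua_def[symmetric]
  have cong: "derivation_term \<delta> s = derivation_term \<delta> t" if "ua_eq s t" for s t
    using that
  proof induction
    case (ueq_cong_mul s s' t t')
    then show ?case by (metis derivation_term.simps(6) ua.abs_eq_iff)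
  qed (simp_all add: abs_simps algebra_simps scaleQ_add_right scaleQ_add_left scaleQ_scaleQ
      scaleQ_one mult_scaleQ_left mult_scaleQ_right qlinearD[OF ua_gen_linear] ua_gen_bracket
      qlinearD[OF assms(1)] assms(2))
  define D where "D u = derivation_term \<delta> (rep_ua u)" for u
  have abs: "D (abs_ua t) = derivation_term \<delta> t" for t
    unfolding D_def by (rule cong, rule Quotient_rep_abs[OF Quotient_ua]) (rule ueq_refl)
  have surj: "\<exists>t. u = abs_ua t" for u :: "'a ua"
    by (metis Quotient_abs_rep[OF Quotient_ua])
  have "D (u + v) = D u + D v" "D (q *\<^sub>Q u) = q *\<^sub>Q D u" "D (u * v) = D u * v + u * D v" for u v q
    using surj[of u] surj[of v]
    by (auto simp: plus_ua.abs_eq scaleQ_ua.abs_eq times_ua.abs_eq abs)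
  moreover have "D (\<iota> x) = \<iota> (\<delta> x)" for x
    by (simp add: ua_gen.abs_eq abs)
  ultimately show "\<exists>D. derivation D \<and> (\<forall>x. D (\<iota> x) = \<iota> (\<delta> x))"
    by (auto simp: derivation_def intro!: exI[of _ D] qlinearI)
next
  fix D E
  assume *: "derivation D \<and> (\<forall>x. D (\<iota> x) = \<iota> (\<delta> x))" "derivation E \<and> (\<forall>x. E (\<iota> x) = \<iota> (\<delta> x))"
  have one: "F 1 = 0" if "derivation F" for F :: "'a ua \<Rightarrow> 'a ua"
    using that[unfolded derivation_def] by (metis add_cancel_right_right mult_1 mult_1_right)
  then have "D 1 = 0" "E 1 = 0"
    using * by (simp_all add: one)
  show "D = E"
  proof
    show "D u = E u" for u
      by (induction u rule: ua_induct) (use * \<open>D 1 = 0\<close> \<open>E 1 = 0\<close> in \<open>simp_all add: derivation_def qlinearD\<close>)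
  qed
qed

lemma extend_derivation:
  assumes "qlinear \<delta>" "\<And>x y. \<delta> (bracket x y) = bracket (\<delta> x) y + bracket x (\<delta> y)"
  shows extend_derivation_derivation: "derivation (extend_derivation \<delta>)"
    and extend_derivation_gen: "extend_derivation \<delta> (\<iota> x) = \<iota> (\<delta> x)"
  unfolding extend_derivation_def using theI'[OF ex1_extend_derivation[OF assms]] by blast+

definition D_op :: "('a::lie_algebra \<Rightarrow> 'a) \<Rightarrow> 'a ua \<Rightarrow> 'a ua"
  where "D_op \<delta> = antipode \<star> extend_derivation \<delta>"


section \<open>Grading and completion\<close>

inductive ua_homog :: "nat \<Rightarrow> 'a::graded_lie_algebra ua \<Rightarrow> bool" where
  ua_homog_zero: "ua_homog n 0"
| ua_homog_one: "ua_homog 0 1"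
| ua_homog_gen: "x \<in> homog n \<Longrightarrow> ua_homog n (\<iota> x)"
| ua_homog_add: "ua_homog n u \<Longrightarrow> ua_homog n v \<Longrightarrow> ua_homog n (u + v)"
| ua_homog_scale: "ua_homog n u \<Longrightarrow> ua_homog n (q *\<^sub>Q u)"
| ua_homog_mult: "ua_homog m u \<Longrightarrow> ua_homog n v \<Longrightarrow> ua_homog (m + n) (u * v)"

text \<open>The completion \<open>\<Prod>\<^sub>n U(L)\<^sub>n\<close> sits in \<open>U(L)[[t]]\<close> as the series whose \<open>n\<close>-th coefficient
  is homogeneous of degree \<open>n\<close>: its product is the Cauchy product and its topology (product of
  discrete spaces) is induced by the metric on formal power series.  The completion of \<open>L\<close> is
  represented in the same way by sequences of type \<open>'a fps\<close>.\<close>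

definition ua_completion :: "'a::graded_lie_algebra ua fps set"
  where "ua_completion = {u. \<forall>n. ua_homog n (fps_nth u n)}"

definition to_completion :: "'a::graded_lie_algebra \<Rightarrow> 'a fps"
  where "to_completion x = Abs_fps (\<lambda>n. hcomp n x)"

text \<open>Degree by degree extension of a graded map.\<close>

definition extend_completion :: "('a \<Rightarrow> 'b) \<Rightarrow> 'a fps \<Rightarrow> 'b fps"
  where "extend_completion f u = Abs_fps (\<lambda>n. f (fps_nth u n))"

definition exp_completion :: "'a::graded_lie_algebra \<Rightarrow> 'a ua fps" where
  "exp_completion l = (\<Sum>k. (1 / fact k) *\<^sub>Q extend_completion \<iota> (to_completion l) ^ k)"

text \<open>The power series \<open>(exp (- ad\<^sub>l) - 1) / (- ad\<^sub>l)\<close> applied to \<open>y\<close>, an element of the completion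
  of \<open>L\<close>.\<close>

definition exp_ad_quotient :: "'a::graded_lie_algebra \<Rightarrow> 'a \<Rightarrow> 'a fps" where
  "exp_ad_quotient l y =
    (\<Sum>i. (1 / fact (i + 1)) *\<^sub>Q to_completion (((\<lambda>z. - bracket l z) ^^ i) y))"


subsection \<open>The series converge in the completions\<close>

lemma fps_sums_locally_finite:
  fixes a :: "nat \<Rightarrow> 'a::ab_group_add fps"
  assumes "\<And>k n. n < k \<Longrightarrow> fps_nth (a k) n = 0"
  shows "a sums Abs_fps (\<lambda>n. \<Sum>k\<le>n. fps_nth (a k) n)" (is "a sums ?s")
  unfolding sums_def LIMSEQ_def
proof (intro allI impI)
  fix e :: real
  assume "e > 0"
  then obtain N where N: "inverse (2 ^ N) < e"
    using real_arch_pow_inv[of e "1/2"] by (auto simp: power_one_over inverse_eq_divide)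
  have "dist (\<Sum>k<m. a k) ?s < e" if "m \<ge> N" for m
  proof (cases "(\<Sum>k<m. a k) = ?s")
    case False
    have "fps_nth ((\<Sum>k<m. a k) - ?s) n = 0" if "n < m" for n
    proof -
      have "(\<Sum>k<m. fps_nth (a k) n) = (\<Sum>k\<le>n. fps_nth (a k) n)"
        by (rule sum.mono_neutral_right) (use that assms in auto)
      then show ?thesis by (simp add: fps_sum_nth)
    qed
    then have "m \<le> subdegree ((\<Sum>k<m. a k) - ?s)"
      using False by (intro subdegree_geI) auto
    then have "inverse (2 ^ subdegree ((\<Sum>k<m. a k) - ?s)) \<le> (inverse (2 ^ N) :: real)"
      using that by (intro le_imp_inverse_le power_increasing) auto
    also note N
    finally show ?thesis using False by (simp add: dist_fps_def)
  qed (use \<open>e > 0\<close> in simp)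
  then show "\<exists>N. \<forall>m\<ge>N. dist (\<Sum>k<m. a k) ?s < e" by blast
qed

lemma hcomp_homog: "hcomp n x \<in> homog n"
  using theI'[OF homog_decomp[of x]] by (simp add: hcomp_def)

lemma hcomp_unique:
  assumes "\<And>n. c n \<in> homog n" "finite {n. c n \<noteq> 0}" "x = (\<Sum>n | c n \<noteq> 0. c n)"
  shows "hcomp n x = c n"
  unfolding hcomp_def using the1_equality[OF homog_decomp[of x], of c] assms by simp

lemma hcomp_0: "hcomp 0 x = 0"
  using hcomp_homog[of 0 x] homog_0 by auto

lemma hcomp_finite: "finite {n. hcomp n x \<noteq> 0}"
  and hcomp_sum: "x = (\<Sum>n | hcomp n x \<noteq> 0. hcomp n x)"
  using theI'[OF homog_decomp[of x]] by (simp_all add: hcomp_def)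

lemma hcomp_linear: "qlinear (hcomp n)"
proof (rule qlinearI)
  fix x y :: 'a and q
  let ?S = "{n. hcomp n x \<noteq> 0} \<union> {n. hcomp n y \<noteq> 0}"
  have fin: "finite ?S" by (simp add: hcomp_finite)
  have x: "x = (\<Sum>n\<in>?S. hcomp n x)" and y: "y = (\<Sum>n\<in>?S. hcomp n y)"
    by (subst hcomp_sum, rule sum.mono_neutral_left; use fin in auto)+
  show "hcomp n (x + y) = hcomp n x + hcomp n y"
  proof (rule hcomp_unique[where c = "\<lambda>n. hcomp n x + hcomp n y"])
    show "finite {n. hcomp n x + hcomp n y \<noteq> 0}"
      by (rule finite_subset[OF _ fin]) auto
    have "x + y = (\<Sum>n\<in>?S. hcomp n x + hcomp n y)"
      using x y by (simp add: sum.distrib)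
    also have "\<dots> = (\<Sum>n | hcomp n x + hcomp n y \<noteq> 0. hcomp n x + hcomp n y)"
      by (rule sum.mono_neutral_right[OF fin]) auto
    finally show "x + y = (\<Sum>n | hcomp n x + hcomp n y \<noteq> 0. hcomp n x + hcomp n y)" .
  qed (intro homog_add hcomp_homog)
  show "hcomp n (q *\<^sub>Q x) = q *\<^sub>Q hcomp n x"
  proof (rule hcomp_unique[where c = "\<lambda>n. q *\<^sub>Q hcomp n x"])
    show "finite {n. q *\<^sub>Q hcomp n x \<noteq> 0}"
      by (rule finite_subset[OF _ hcomp_finite[of x]]) auto
    have "q *\<^sub>Q x = (\<Sum>n | hcomp n x \<noteq> 0. q *\<^sub>Q hcomp n x)"
      by (subst hcomp_sum[of x]) (rule rat_vector.scale_sum_right)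
    also have "\<dots> = (\<Sum>n | q *\<^sub>Q hcomp n x \<noteq> 0. q *\<^sub>Q hcomp n x)"
      by (rule sum.mono_neutral_right[OF hcomp_finite]) auto
    finally show "q *\<^sub>Q x = (\<Sum>n | q *\<^sub>Q hcomp n x \<noteq> 0. q *\<^sub>Q hcomp n x)" .
  qed (intro homog_scaleQ hcomp_homog)
qed

lemma hcomp_of_homog:
  assumes "x \<in> homog m"
  shows "hcomp n x = (if n = m then x else 0)"
proof (rule hcomp_unique)
  have "{n. (if n = m then x else 0) \<noteq> 0} = (if x = 0 then {} else {m})" by auto
  then show "finite {n. (if n = m then x else 0) \<noteq> 0}"
    and "x = (\<Sum>n | (if n = m then x else 0) \<noteq> 0. if n = m then x else 0)" by simp_all
qed (use assms homog_zero in auto)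

lemma qlinear_sum: "qlinear f \<Longrightarrow> f (sum g A) = (\<Sum>i\<in>A. f (g i))"
  by (induction A rule: infinite_finite_induct) (simp_all add: qlinearD)

lemma bracket_linear: "qlinear (bracket x)" "qlinear (\<lambda>x. bracket x y)"
  by (rule qlinearI;
      simp add: bracket_add_left bracket_add_right bracket_scaleQ_left bracket_scaleQ_right)+

lemma hcomp_bracket:
  assumes "\<And>m. m < k \<Longrightarrow> hcomp m y = 0" and "n \<le> k"
  shows "hcomp n (bracket l y) = 0"
proof -
  let ?L = "{i. hcomp i l \<noteq> 0}" and ?Y = "{j. hcomp j y \<noteq> 0}"
  have "bracket l y = bracket (\<Sum>i\<in>?L. hcomp i l) (\<Sum>j\<in>?Y. hcomp j y)"
    by (simp flip: hcomp_sum)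
  also have "\<dots> = (\<Sum>i\<in>?L. \<Sum>j\<in>?Y. bracket (hcomp i l) (hcomp j y))"
    by (simp only: qlinear_sum[OF bracket_linear(2)], simp only: qlinear_sum[OF bracket_linear(1)])
  finally have "hcomp n (bracket l y) =
      (\<Sum>i\<in>?L. \<Sum>j\<in>?Y. hcomp n (bracket (hcomp i l) (hcomp j y)))"
    by (simp add: qlinear_sum[OF hcomp_linear])
  also have "\<dots> = 0"
  proof (intro sum.neutral ballI)
    fix i j assume "i \<in> ?L" "j \<in> ?Y"
    then have "i \<noteq> 0" "\<not> j < k"
      using assms(1) by (auto simp: hcomp_0 intro: ccontr)
    then have "n \<noteq> i + j" using assms(2) by auto
    then show "hcomp n (bracket (hcomp i l) (hcomp j y)) = 0"
      using hcomp_of_homog[OF bracket_homog[OF hcomp_homog hcomp_homog], of n i l j y] by simp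
  qed
  finally show ?thesis .
qed

lemma exp_ad_quotient_sums:
  "(\<lambda>i. (1 / fact (i + 1)) *\<^sub>Q to_completion (((\<lambda>z. - bracket l z) ^^ i) y)) sums exp_ad_quotient l y"
  and exp_ad_quotient_nth: "fps_nth (exp_ad_quotient l y) n =
    (\<Sum>i\<le>n. (1 / fact (i + 1)) *\<^sub>Q hcomp n (((\<lambda>z. - bracket l z) ^^ i) y))"
proof -
  have "hcomp n (((\<lambda>z. - bracket l z) ^^ i) y) = 0" if "n < i" for n i
    using that
  proof (induction i arbitrary: n)
    case (Suc i)
    have "hcomp n (bracket l (((\<lambda>z. - bracket l z) ^^ i) y)) = 0"
      by (rule hcomp_bracket[of i]) (use Suc in auto)
    then show ?case by (simp add: qlinearD[OF hcomp_linear])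
  qed simp
  then have *: "(\<lambda>i. (1 / fact (i + 1)) *\<^sub>Q to_completion (((\<lambda>z. - bracket l z) ^^ i) y)) sums
    Abs_fps (\<lambda>n. \<Sum>i\<le>n.
      fps_nth ((1 / fact (i + 1)) *\<^sub>Q to_completion (((\<lambda>z. - bracket l z) ^^ i) y)) n)"
    by (intro fps_sums_locally_finite) (simp add: to_completion_def)
  then show "(\<lambda>i. (1 / fact (i + 1)) *\<^sub>Q to_completion (((\<lambda>z. - bracket l z) ^^ i) y)) sums
      exp_ad_quotient l y"
    by (simp only: exp_ad_quotient_def sums_unique[OF *, symmetric])
  show "fps_nth (exp_ad_quotient l y) n =
      (\<Sum>i\<le>n. (1 / fact (i + 1)) *\<^sub>Q hcomp n (((\<lambda>z. - bracket l z) ^^ i) y))"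
    unfolding exp_ad_quotient_def sums_unique[OF *, symmetric]
    by (simp add: to_completion_def)
qed

lemma ua_homog_sum: "(\<And>i. i \<in> A \<Longrightarrow> ua_homog n (f i)) \<Longrightarrow> ua_homog n (sum f A)"
  by (induction A rule: infinite_finite_induct) (auto intro: ua_homog.intros)

lemma ua_homog_power:
  assumes "u \<in> ua_completion"
  shows "u ^ k \<in> ua_completion"
proof (induction k)
  case 0
  then show ?case by (auto simp: ua_completion_def intro: ua_homog.intros)
next
  case (Suc k)
  have "ua_homog n (\<Sum>i=0..n. fps_nth u i * fps_nth (u ^ k) (n - i))" for n
  proof (rule ua_homog_sum)
    fix i assume "i \<in> {0..n}"
    moreover have "ua_homog (i + (n - i)) (fps_nth u i * fps_nth (u ^ k) (n - i))"
      using assms Suc by (intro ua_homog_mult) (simp_all add: ua_completion_def)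
    ultimately show "ua_homog n (fps_nth u i * fps_nth (u ^ k) (n - i))" by simp
  qed
  then show ?case by (simp add: ua_completion_def fps_mult_nth)
qed

lemma fps_power_nth_below:
  fixes u :: "'a::ring_1 fps"
  assumes "fps_nth u 0 = 0" "n < k"
  shows "fps_nth (u ^ k) n = 0"
  using assms(2)
proof (induction k arbitrary: n)
  case (Suc k)
  have "fps_nth u i * fps_nth (u ^ k) (n - i) = 0" if "i \<le> n" for i
  proof (cases "i = 0")
    case False
    then have "n - i < k" using Suc.prems that by auto
    then show ?thesis by (simp add: Suc.IH)
  qed (simp add: assms(1))
  then show ?case by (simp add: fps_mult_nth)
qed simp

lemma iota_completion: "extend_completion \<iota> (to_completion l) \<in> ua_completion"
  by (simp add: ua_completion_def extend_completion_def to_completion_def ua_homog_gen hcomp_homog)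

lemma exp_completion_sums:
  "(\<lambda>k. (1 / fact k) *\<^sub>Q extend_completion \<iota> (to_completion l) ^ k) sums exp_completion l"
  and exp_completion_nth: "fps_nth (exp_completion l) n =
    (\<Sum>k\<le>n. (1 / fact k) *\<^sub>Q fps_nth (extend_completion \<iota> (to_completion l) ^ k) n)"
proof -
  have "fps_nth (extend_completion \<iota> (to_completion l)) 0 = 0"
    by (simp add: extend_completion_def to_completion_def hcomp_0 qlinearD[OF ua_gen_linear])
  then have *: "(\<lambda>k. (1 / fact k) *\<^sub>Q extend_completion \<iota> (to_completion l) ^ k) sums
    Abs_fps (\<lambda>n. \<Sum>k\<le>n. fps_nth ((1 / fact k) *\<^sub>Q extend_completion \<iota> (to_completion l) ^ k) n)"
    by (intro fps_sums_locally_finite) (simp add: fps_power_nth_below)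
  then show "(\<lambda>k. (1 / fact k) *\<^sub>Q extend_completion \<iota> (to_completion l) ^ k) sums exp_completion l"
    by (simp only: exp_completion_def sums_unique[OF *, symmetric])
  show "fps_nth (exp_completion l) n =
      (\<Sum>k\<le>n. (1 / fact k) *\<^sub>Q fps_nth (extend_completion \<iota> (to_completion l) ^ k) n)"
    unfolding exp_completion_def sums_unique[OF *, symmetric] by simp
qed

lemma exp_completion_in: "exp_completion l \<in> ua_completion"
  using ua_homog_power[OF iota_completion[of l]]
  by (simp add: ua_completion_def exp_completion_nth ua_homog_sum ua_homog_scale)


subsection \<open>The operator \<open>S \<star> \<delta>\<close> is graded\<close>

inductive tensor_homog :: "nat \<Rightarrow> ('a::graded_lie_algebra ua, 'a ua) tensor \<Rightarrow> bool" where
  tensor_homog_pure: "ua_homog i a \<Longrightarrow> ua_homog j b \<Longrightarrow> tensor_homog (i + j) (a \<otimes>\<^sub>t b)"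
| tensor_homog_add: "tensor_homog n s \<Longrightarrow> tensor_homog n t \<Longrightarrow> tensor_homog n (s + t)"

lemma tensor_homog_scale: "tensor_homog n t \<Longrightarrow> tensor_homog n (q *\<^sub>Q t)"
proof (induction rule: tensor_homog.induct)
  case (tensor_homog_pure i a j b)
  then show ?case
    using tensor_homog.tensor_homog_pure[OF ua_homog_scale[of i a q], of j b]
    by (simp add: pure_tensor_bilinear)
qed (simp add: scaleQ_add_right tensor_homog.tensor_homog_add)

lemma tensor_homog_mult:
  assumes "tensor_homog m s" "tensor_homog n t"
  shows "tensor_homog (m + n) (s * t)"
  using assms(1)
proof (induction rule: tensor_homog.induct)
  case (tensor_homog_pure i a j b)
  note ab = tensor_homog_pure
  show ?case
    using assms(2)
  proof (induction rule: tensor_homog.induct)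
    case (tensor_homog_pure k c l d)
    have "tensor_homog ((i + k) + (j + l)) ((a * c) \<otimes>\<^sub>t (b * d))"
      by (intro tensor_homog.tensor_homog_pure ua_homog_mult ab tensor_homog_pure)
    then show ?case by (simp add: times_tensor_pure add_ac)
  qed (simp add: distrib_left tensor_homog.tensor_homog_add)
qed (simp add: distrib_right tensor_homog.tensor_homog_add)

lemma coproduct_homog: "ua_homog n u \<Longrightarrow> tensor_homog n (coproduct u)"
proof (induction rule: ua_homog.induct)
  note hom = coproduct_hom[unfolded algebra_hom_def]
  note lin = qlinearD[OF conjunct1[OF hom]]
  {
    case (ua_homog_zero n)
    have "tensor_homog (n + 0) (0 *\<^sub>Q (0 \<otimes>\<^sub>t 1) :: ('a ua, 'a ua) tensor)"
      by (intro tensor_homog_scale tensor_homog_pure ua_homog.intros)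
    then show ?case by (simp add: lin)
  next
    case ua_homog_one
    show ?case using tensor_homog_pure[OF ua_homog.ua_homog_one ua_homog.ua_homog_one]
      by (simp add: hom one_tensor_def)
  next
    case (ua_homog_gen x n)
    then have "ua_homog n (\<iota> x)" by (rule ua_homog.intros)
    then show ?case
      using tensor_homog_pure[OF _ ua_homog_one, of n "\<iota> x"]
        tensor_homog_pure[OF ua_homog_one, of n "\<iota> x"]
      by (simp add: coproduct_gen tensor_homog_add)
  }
qed (simp_all add: coproduct_hom[unfolded algebra_hom_def] tensor_homog_mult tensor_homog_add
    tensor_homog_scale qlinearD[OF conjunct1[OF coproduct_hom[unfolded algebra_hom_def]]])

lemma antipode_homog: "ua_homog n u \<Longrightarrow> ua_homog n (antipode u)"
proof (induction rule: ua_homog.induct)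
  case (ua_homog_gen x n)
  then show ?case
    using ua_homog_scale[OF ua_homog.ua_homog_gen, of x n "- 1"] by (simp add: antipode_gen)
next
  case (ua_homog_mult m u n v)
  then show ?case
    using ua_homog.ua_homog_mult[of n "antipode v" m "antipode u"] by (simp add: antipode_mult add_ac)
qed (simp_all add: qlinearD[OF antipode_linear] antipode_one ua_homog.intros)

lemma derivation_one: "derivation D \<Longrightarrow> D 1 = 0"
  unfolding derivation_def by (metis add_cancel_right_right mult_1 mult_1_right)

lemma extend_derivation_homog:
  assumes "graded_lie_derivation \<delta>" "ua_homog n u"
  shows "ua_homog n (extend_derivation \<delta> u)"
proof -
  have \<delta>: "qlinear \<delta>" "\<And>x y. \<delta> (bracket x y) = bracket (\<delta> x) y + bracket x (\<delta> y)"
    "\<And>x n. x \<in> homog n \<Longrightarrow> \<delta> x \<in> homog n"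
    using assms(1) unfolding graded_lie_derivation_def by blast+
  note der = extend_derivation_derivation[OF \<delta>(1,2)]
  note der' = der[unfolded derivation_def]
  show ?thesis
    using assms(2)
  proof (induction rule: ua_homog.induct)
    case (ua_homog_mult m u n v)
    then show ?case by (simp add: der' ua_homog_add ua_homog.ua_homog_mult)
  qed (simp_all add: qlinearD[OF conjunct1[OF der']] derivation_one[OF der]
      extend_derivation_gen[OF \<delta>(1,2)] \<delta>(3) ua_homog.intros)
qed

lemma convolution_homog:
  assumes "qlinear f" "qlinear g"
    and "\<And>n u. ua_homog n u \<Longrightarrow> ua_homog n (f u)" "\<And>n u. ua_homog n u \<Longrightarrow> ua_homog n (g u)"
    and "ua_homog n u"
  shows "ua_homog n ((f \<star> g) u)"
proof -
  have "ua_homog n (mult_map (tensor_map f g t))" if "tensor_homog n t" for t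
    using that
    by (induction rule: tensor_homog.induct)
      (simp_all add: assms tensor_map_pure mult_map_pure qlinearD[OF mult_map_linear]
        qlinearD[OF tensor_map_linear] ua_homog.intros)
  then show ?thesis
    using coproduct_homog[OF assms(5)] by (simp add: convolution_def)
qed

lemma D_op_homog:
  assumes "graded_lie_derivation \<delta>" "ua_homog n u"
  shows "ua_homog n (D_op \<delta> u)"
proof -
  have "derivation (extend_derivation \<delta>)"
    by (rule extend_derivation_derivation) (use assms(1) in \<open>auto simp: graded_lie_derivation_def\<close>)
  then show ?thesis
    unfolding D_op_def
    by (intro convolution_homog antipode_linear antipode_homog extend_derivation_homog assms)
      (auto simp: derivation_def)
qed

end

theory Submission
  imports Defs
begin

text \<open>The formula is an identity in \<open>U(L)\<close>, transported to the completion one power of \<open>l\<close> at a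
  time.

  In \<open>U(L)\<close>, write \<open>\<Delta>(u) = \<Sum> u\<^sub>1 \<otimes> u\<^sub>2\<close>.  Since \<open>x\<close> in \<open>L\<close> is primitive and \<open>S(x) = - x\<close>,
  \<open>(S \<star> g)(x u) = \<Sum> S(u\<^sub>1) (g(x u\<^sub>2) - x g(u\<^sub>2))\<close>
  for every linear \<open>g\<close> (\<open>antipode_convolution_gen_mult\<close>).  For \<open>g = \<delta>\<close> the difference is \<open>\<delta>(x) u\<^sub>2\<close>;
  for \<open>g = (v \<mapsto> z v)\<close> with \<open>z\<close> in \<open>L\<close> it is \<open>- [x, z] u\<^sub>2\<close>.  So a first factor \<open>x\<close> of the argument
  turns \<open>S \<star> \<delta>\<close> into the convolution of \<open>S\<close> with multiplication by \<open>\<delta>(x)\<close>, and each further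
  factor \<open>x\<close> applies \<open>- ad\<^sub>x\<close> to the multiplier:
  \<open>D\<^sub>\<delta>(x\<^sup>k\<^sup>+\<^sup>1) = (- ad\<^sub>x)\<^sup>k (\<delta>(x))\<close> (\<open>D_op_power_gen\<close>).  Dividing by \<open>(k + 1)!\<close> and
  summing gives the theorem, up to the meaning of the infinite sum.

  The completion is handled by the algebra homomorphism from \<open>U(L)\<close> to \<open>U(L)[[t]]\<close> that expands
  an element into its homogeneous components (\<open>ua_components\<close>).  Being multiplicative, it sends \<open>l\<^sup>k\<close>
  to the \<open>k\<close>-th power of the series of components of \<open>l\<close>, which is what occurs in \<open>exp(l)\<close>; and it
  commutes with the degree by degree extension of every graded linear map, notably of \<open>D\<^sub>\<delta>\<close>
  (\<open>extend_completion_ua_components\<close>).  Hence every coefficient of the formula is a finite sum of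
  instances of the identity above.\<close>

section \<open>Values on powers of a Lie element\<close>

lemma mult_left_linear:
  fixes a :: "'a::rat_algebra"
  shows "qlinear (\<lambda>v. a * v)"
  by (rule qlinearI) (simp_all add: distrib_left mult_scaleQ_right)

text \<open>The coproduct of \<open>x u\<close> is \<open>\<Sum> x u\<^sub>1 \<otimes> u\<^sub>2 + \<Sum> u\<^sub>1 \<otimes> x u\<^sub>2\<close>, and \<open>S(x u\<^sub>1) = - S(u\<^sub>1) x\<close> moves the
  factor \<open>x\<close> of the first sum to the left of \<open>g(u\<^sub>2)\<close>.\<close>

lemma antipode_convolution_gen_mult:
  assumes "qlinear g"
  shows "(antipode \<star> g) (\<iota> x * u) = (antipode \<star> (\<lambda>v. g (\<iota> x * v) - \<iota> x * g v)) u"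
proof -
  let ?h = "\<lambda>v. g (\<iota> x * v) - \<iota> x * g v"
  have h: "qlinear ?h"
    by (rule qlinearI)
      (simp_all add: qlinearD[OF assms] distrib_left mult_scaleQ_right rat_vector.scale_right_diff_distrib)
  have "mult_map (tensor_map antipode g (coproduct (\<iota> x) * t)) = mult_map (tensor_map antipode ?h t)"
    for t
    by (induction t rule: tensor_induct)
      (simp_all add: coproduct_gen distrib_left distrib_right times_tensor_pure
        tensor_map_pure[OF antipode_linear assms] tensor_map_pure[OF antipode_linear h]
        qlinearD[OF tensor_map_linear[OF antipode_linear assms]]
        qlinearD[OF tensor_map_linear[OF antipode_linear h]]
        qlinearD[OF mult_map_linear] mult_map_pure antipode_mult antipode_gen mult.assoc
        right_diff_distrib)
  then show ?thesis
    by (simp add: convolution_def coproduct_hom[unfolded algebra_hom_def])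
qed

lemma antipode_convolution_one:
  assumes "qlinear g"
  shows "(antipode \<star> g) 1 = g 1"
  by (simp add: convolution_def coproduct_hom[unfolded algebra_hom_def] one_tensor_def mult_map_pure antipode_one
      tensor_map_pure[OF antipode_linear assms])

text \<open>The operator \<open>S \<star> (v \<mapsto> z v)\<close> is the right adjoint action \<open>u \<mapsto> \<Sum> S(u\<^sub>1) z u\<^sub>2\<close> on \<open>z\<close>, under
  which a Lie element \<open>x\<close> acts by \<open>- ad\<^sub>x\<close>.\<close>

lemma right_adjoint_power:
  "(antipode \<star> (\<lambda>v. \<iota> z * v)) (\<iota> x ^ k) = \<iota> (((\<lambda>y. - bracket x y) ^^ k) z)"
proof (induction k arbitrary: z)
  case 0
  then show ?case by (simp add: antipode_convolution_one[OF mult_left_linear])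
next
  case (Suc k)
  have "(\<lambda>v. \<iota> z * (\<iota> x * v) - \<iota> x * (\<iota> z * v)) = (\<lambda>v. \<iota> (- bracket x z) * v)"
    by (simp add: qlinearD[OF ua_gen_linear] ua_gen_bracket left_diff_distrib mult.assoc)
  then show ?case
    by (simp add: antipode_convolution_gen_mult[OF mult_left_linear] Suc.IH funpow_Suc_right
        del: funpow.simps)
qed

lemma D_op_one:
  assumes "qlinear \<delta>" "\<And>x y. \<delta> (bracket x y) = bracket (\<delta> x) y + bracket x (\<delta> y)"
  shows "D_op \<delta> 1 = 0"
  using extend_derivation_derivation[OF assms]
  by (simp add: D_op_def derivation_def antipode_convolution_one derivation_one)

lemma D_op_power_gen:
  assumes "qlinear \<delta>" "\<And>x y. \<delta> (bracket x y) = bracket (\<delta> x) y + bracket x (\<delta> y)"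
  shows "D_op \<delta> (\<iota> x ^ Suc k) = \<iota> (((\<lambda>y. - bracket x y) ^^ k) (\<delta> x))"
proof -
  let ?D = "extend_derivation \<delta>"
  have der: "qlinear ?D" "\<And>u v. ?D (u * v) = ?D u * v + u * ?D v"
    using extend_derivation_derivation[OF assms] by (simp_all add: derivation_def)
  have "(\<lambda>v. ?D (\<iota> x * v) - \<iota> x * ?D v) = (\<lambda>v. \<iota> (\<delta> x) * v)"
    by (simp add: der(2) extend_derivation_gen[OF assms])
  then show ?thesis
    by (simp add: D_op_def antipode_convolution_gen_mult[OF der(1)] right_adjoint_power)
qed

section \<open>Expansion into homogeneous components\<close>

instance fps :: ("{rat_algebra, ring_1}") rat_algebra
  by standard
    (simp_all add: fps_eq_iff fps_mult_nth mult_scaleQ_left mult_scaleQ_right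
      rat_vector.scale_sum_right)

lemma homog_induct [case_names homog add]:
  fixes x :: "'a::graded_lie_algebra"
  assumes "\<And>n x. x \<in> homog n \<Longrightarrow> P x" "\<And>x y. P x \<Longrightarrow> P y \<Longrightarrow> P (x + y)"
  shows "P x"
proof -
  have "P (sum (\<lambda>n. hcomp n x) A)" for A
    by (induction A rule: infinite_finite_induct)
      (auto intro: assms hcomp_homog homog_zero)
  then show ?thesis by (subst hcomp_sum)
qed

lemma hcomp_bracket_convolution:
  "hcomp n (bracket x y) = (\<Sum>i=0..n. bracket (hcomp i x) (hcomp (n - i) y))"
proof (induction x rule: homog_induct)
  case (homog a x)
  then show ?case
  proof (induction y rule: homog_induct)
    case (homog b y)
    have "(\<Sum>i=0..n. bracket (hcomp i x) (hcomp (n - i) y)) =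
        (\<Sum>i=0..n. if i = a then if n - a = b then bracket x y else 0 else 0)"
      by (rule sum.cong)
        (auto simp: hcomp_of_homog[OF homog(1)] hcomp_of_homog[OF homog(2)]
          qlinearD[OF bracket_linear(1)] qlinearD[OF bracket_linear(2)])
    also have "\<dots> = (if n = a + b then bracket x y else 0)"
      by auto
    also have "\<dots> = hcomp n (bracket x y)"
      by (simp add: hcomp_of_homog[OF bracket_homog[OF homog(2,1)]])
    finally show ?case ..
  next
    case (add y z)
    then show ?case by (simp add: qlinearD[OF hcomp_linear] bracket_add_right sum.distrib)
  qed
next
  case (add x z)
  then show ?case by (simp add: qlinearD[OF hcomp_linear] bracket_add_left sum.distrib)
qed

text \<open>The components of \<open>[x, y]\<close> are the Cauchy product, with the bracket as multiplication, of
  those of \<open>x\<close> and \<open>y\<close>; this becomes a commutator in \<open>U(L)[[t]]\<close> because \<open>t\<close> is central.\<close>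

lemma components_lie_hom:
  "lie_hom (\<lambda>x :: 'a::graded_lie_algebra. extend_completion \<iota> (to_completion x))"
  unfolding lie_hom_def
proof (intro conjI allI)
  show "qlinear (\<lambda>x :: 'a. extend_completion \<iota> (to_completion x))"
    by (rule qlinearI)
      (simp_all add: fps_eq_iff extend_completion_def to_completion_def qlinearD[OF hcomp_linear]
        qlinearD[OF ua_gen_linear])
  fix x y :: 'a
  have "(\<Sum>i=0..n. \<iota> (hcomp (n - i) y) * \<iota> (hcomp i x)) =
      (\<Sum>i=0..n. \<iota> (hcomp i y) * \<iota> (hcomp (n - i) x))" for n
    by (subst sum.atLeastAtMost_rev) simp
  then show "extend_completion \<iota> (to_completion (bracket x y)) =
      extend_completion \<iota> (to_completion x) * extend_completion \<iota> (to_completion y) -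
      extend_completion \<iota> (to_completion y) * extend_completion \<iota> (to_completion x)"
    by (simp add: fps_eq_iff extend_completion_def to_completion_def fps_mult_nth
        hcomp_bracket_convolution qlinear_sum[OF ua_gen_linear] ua_gen_bracket sum_subtractf)
qed

text \<open>The grading as an algebra homomorphism: an element \<open>u\<close> of degree \<open>n\<close> is sent to \<open>u t\<^sup>n\<close>.
  Defining it by the universal property, rather than by choosing a decomposition in \<open>U(L)\<close>, makes
  it multiplicative and well-defined at once, and shows that the sum of the \<open>U(L)\<^sub>n\<close> is direct.\<close>

definition ua_components :: "'a::graded_lie_algebra ua \<Rightarrow> 'a ua fps"
  where "ua_components = ua_lift (\<lambda>x. extend_completion \<iota> (to_completion x))"

lemma ua_components_gen: "ua_components (\<iota> x) = extend_completion \<iota> (to_completion x)"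
  by (simp add: ua_components_def ua_lift_gen[OF components_lie_hom])

lemma ua_components_hom: "algebra_hom ua_components"
  by (simp add: ua_components_def ua_lift_hom[OF components_lie_hom])

lemmas ua_components_linear = conjunct1[OF ua_components_hom[unfolded algebra_hom_def]]

lemma ua_components_power: "ua_components (u ^ k) = ua_components u ^ k"
  by (induction k) (simp_all add: ua_components_hom[unfolded algebra_hom_def])

lemma ua_components_homog:
  "ua_homog m u \<Longrightarrow> fps_nth (ua_components u) n = (if n = m then u else 0)"
proof (induction arbitrary: n rule: ua_homog.induct)
  case (ua_homog_gen x m)
  then show ?case
    by (simp add: ua_components_gen extend_completion_def to_completion_def hcomp_of_homog
        qlinearD[OF ua_gen_linear])
next
  case (ua_homog_mult a u b v)
  have "fps_nth (ua_components (u * v)) n =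
      (\<Sum>i=0..n. (if i = a then u else 0) * (if n - i = b then v else 0))"
    by (simp add: ua_components_hom[unfolded algebra_hom_def] fps_mult_nth ua_homog_mult.IH)
  also have "\<dots> = (\<Sum>i=0..n. if i = a then if n - a = b then u * v else 0 else 0)"
    by (rule sum.cong) auto
  finally show ?case by auto
qed (simp_all add: ua_components_hom[unfolded algebra_hom_def] qlinearD[OF ua_components_linear])

lemma ua_homog_span: "(u :: 'a::graded_lie_algebra ua) \<in> rat_vector.span {v. \<exists>n. ua_homog n v}"
  (is "_ \<in> rat_vector.span ?H")
proof (induction u rule: ua_induct)
  case (gen x)
  show ?case
  proof (induction x rule: homog_induct)
    case (homog n x)
    then show ?case by (intro rat_vector.span_base) (auto intro: ua_homog.intros)
  qed (simp add: qlinearD[OF ua_gen_linear] rat_vector.span_add)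
next
  case one
  show ?case by (intro rat_vector.span_base) (auto intro: ua_homog.intros)
next
  case (mult u v)
  have "a * v \<in> rat_vector.span ?H" if "a \<in> ?H" for a
    using mult(2)
    by (induction v rule: rat_vector.span_induct_alt)
      (use that in \<open>auto simp: distrib_left mult_scaleQ_right rat_vector.span_zero
        intro!: rat_vector.span_add rat_vector.span_scale
        intro: rat_vector.span_base ua_homog.ua_homog_mult\<close>)
  with mult(1) show ?case
    by (induction u rule: rat_vector.span_induct_alt)
      (auto simp: distrib_right mult_scaleQ_left rat_vector.span_zero
        intro!: rat_vector.span_add rat_vector.span_scale)
qed (simp_all add: rat_vector.span_add rat_vector.span_scale)

text \<open>Both sides are linear in \<open>u\<close>, homogeneous elements span \<open>U(L)\<close>, and on an element of degree \<open>m\<close> both are concentrated in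
  degree \<open>m\<close>.\<close>

lemma extend_completion_ua_components:
  assumes "qlinear f" "\<And>n u. ua_homog n u \<Longrightarrow> ua_homog n (f u)"
  shows "extend_completion f (ua_components u) = ua_components (f u)"
proof -
  have "u \<in> rat_vector.span {v. \<exists>n. ua_homog n v}" by (rule ua_homog_span)
  then show ?thesis
  proof (induction u rule: rat_vector.span_induct_alt)
    case base
    show ?case
      by (simp add: fps_eq_iff extend_completion_def qlinearD[OF assms(1)]
          qlinearD[OF ua_components_linear])
  next
    case (step q v w)
    then obtain m where m: "ua_homog m v" by blast
    have "extend_completion f (ua_components v) = ua_components (f v)"
      by (simp add: fps_eq_iff extend_completion_def ua_components_homog[OF m]
          ua_components_homog[OF assms(2)[OF m]] qlinearD[OF assms(1)])
    with step(2) show ?case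
      by (simp add: fps_eq_iff extend_completion_def qlinearD[OF assms(1)]
          qlinearD[OF ua_components_linear])
  qed
qed

section \<open>The formula on exponentials\<close>

theorem theorem13:
  fixes \<delta> :: "'a::graded_lie_algebra \<Rightarrow> 'a" and l :: 'a
  assumes "graded_lie_derivation \<delta>"
  shows "extend_completion (D_op \<delta>) (exp_completion l) =
    extend_completion \<iota> (exp_ad_quotient l (\<delta> l))"
proof (rule fps_ext)
  fix n
  let ?X = "extend_completion \<iota> (to_completion l)"
  let ?ad = "\<lambda>j. ((\<lambda>y. - bracket l y) ^^ j) (\<delta> l)"
  have \<delta>: "qlinear \<delta>" "\<And>x y. \<delta> (bracket x y) = bracket (\<delta> x) y + bracket x (\<delta> y)"
    using assms by (auto simp: graded_lie_derivation_def)
  have lin: "qlinear (D_op \<delta>)"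
    using extend_derivation_derivation[OF \<delta>] unfolding D_op_def derivation_def
    by (intro convolution_linear antipode_linear) auto
  have power: "D_op \<delta> (fps_nth (?X ^ k) n) = fps_nth (ua_components (D_op \<delta> (\<iota> l ^ k))) n" for k
    using extend_completion_ua_components[OF lin D_op_homog[OF assms], of "\<iota> l ^ k"]
    by (simp add: fps_eq_iff extend_completion_def ua_components_power ua_components_gen)
  have power_Suc: "D_op \<delta> (fps_nth (?X ^ Suc j) n) = \<iota> (hcomp n (?ad j))" for j
    using power[of "Suc j"] unfolding D_op_power_gen[OF \<delta>]
    by (simp add: ua_components_gen extend_completion_def to_completion_def)
  have power_0: "D_op \<delta> (fps_nth (?X ^ 0) n) = 0"
    unfolding power by (simp add: D_op_one[OF \<delta>] qlinearD[OF ua_components_linear])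
  have X0: "fps_nth ?X 0 = 0"
    by (simp add: extend_completion_def to_completion_def hcomp_0 qlinearD[OF ua_gen_linear])
  have "fps_nth (extend_completion (D_op \<delta>) (exp_completion l)) n =
      (\<Sum>k\<le>n. (1 / fact k) *\<^sub>Q D_op \<delta> (fps_nth (?X ^ k) n))"
    by (simp add: extend_completion_def[of "D_op \<delta>"] exp_completion_nth qlinear_sum[OF lin]
        qlinearD(2)[OF lin])
  \<comment> \<open>The term \<open>k = n + 1\<close> vanishes because \<open>l\<^sup>n\<^sup>+\<^sup>1\<close> has no component of degree \<open>n\<close>; with it, the
    index shift \<open>k = j + 1\<close> gives the same range as in the series of \<open>- ad\<^sub>l\<close>.\<close>
  also have "\<dots> = (\<Sum>k\<le>Suc n. (1 / fact k) *\<^sub>Q D_op \<delta> (fps_nth (?X ^ k) n))"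
    by (simp only: sum.atMost_Suc fps_power_nth_below[OF X0 lessI] qlinearD(3)[OF lin]
        rat_vector.scale_zero_right add_0_right)
  also have "\<dots> = (\<Sum>j\<le>n. (1 / fact (Suc j)) *\<^sub>Q \<iota> (hcomp n (?ad j)))"
    by (simp only: sum.atMost_Suc_shift power_0 power_Suc rat_vector.scale_zero_right add_0_left)
  also have "\<dots> = fps_nth (extend_completion \<iota> (exp_ad_quotient l (\<delta> l))) n"
    by (simp add: extend_completion_def exp_ad_quotient_nth qlinear_sum[OF ua_gen_linear]
        qlinearD(2)[OF ua_gen_linear])
  finally show "fps_nth (extend_completion (D_op \<delta>) (exp_completion l)) n =
      fps_nth (extend_completion \<iota> (exp_ad_quotient l (\<delta> l))) n" .
qed

end
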